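(* Let $q$ be a prime power, $n\ge3$, $\sigma$ a generator of $\mathrm{Gal}(\mathbb{F}_{q^n}/\mathbb{F}_q)$, and $L=ax+bx^{\sigma}+cx^{\sigma^2}+dx^{\sigma^3}$ with $a,b,c,d\in\mathbb{F}_{q^n}$ and $abcd\neq0$. Then $L$ has $q^3$ roots in $\mathbb{F}_{q^n}$ if and only if $H_{n-1}=H_{n-2}=0$ and $H_nN(c/d)=1$.
   Context: $N(x)=x^{1+\sigma+\dots+\sigma^{n-1}}$ is the norm $\mathbb{F}_{q^n}\to\mathbb{F}_q$. Let $w=\frac{a^\sigma c}{b^{\sigma+1}}$ and $z=\frac{b^\sigma d}{c^{\sigma+1}}$. Define $H_0=1$, $H_1=-1$, $H_2=1-z$, and for $k\ge3$, $H_k=-H_{k-1}-z^{\sigma^{k-2}}H_{k-2}-w^{\sigma^{k-2}}z^{\sigma^{k-2}+\sigma^{k-3}}H_{k-3}$. *)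

theory Defs
  imports "HOL-Algebra.Generated_Groups" "HOL-Number_Theory.Prime_Powers"
begin

definition is_subfield :: "'a::field set \<Rightarrow> bool" where
  "is_subfield K \<longleftrightarrow> 0 \<in> K \<and> 1 \<in> K \<and>
     (\<forall>x\<in>K. \<forall>y\<in>K. x - y \<in> K \<and> x * y \<in> K) \<and> (\<forall>x\<in>K. inverse x \<in> K)"

definition field_automorphisms_over :: "'a::field set \<Rightarrow> ('a \<Rightarrow> 'a) set" where
  "field_automorphisms_over K = {\<tau>. bij \<tau> \<and> (\<forall>x y. \<tau> (x + y) = \<tau> x + \<tau> y) \<and>
     (\<forall>x y. \<tau> (x * y) = \<tau> x * \<tau> y) \<and> (\<forall>x\<in>K. \<tau> x = x)}"

definition Gal :: "'a::field set \<Rightarrow> ('a \<Rightarrow> 'a) monoid" where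
  "Gal K = \<lparr>carrier = field_automorphisms_over K, monoid.mult = (\<circ>), one = id\<rparr>"

lemma group_Gal: "group (Gal K)"
proof (rule groupI)
  fix \<tau> assume "\<tau> \<in> carrier (Gal K)"
  then have t: "bij \<tau>" "\<And>x y. \<tau> (x + y) = \<tau> x + \<tau> y" "\<And>x y. \<tau> (x * y) = \<tau> x * \<tau> y"
      "\<And>x. x \<in> K \<Longrightarrow> \<tau> x = x"
    by (auto simp: Gal_def field_automorphisms_over_def)
  have i: "inv_into UNIV \<tau> y = x \<longleftrightarrow> y = \<tau> x" for x y
    using t(1) by (metis bij_inv_eq_iff)
  have r: "\<tau> (inv_into UNIV \<tau> x) = x" for x
    using i by metis
  have "inv_into UNIV \<tau> \<in> carrier (Gal K)"
    using t bij_imp_bij_inv[OF t(1)] by (auto simp: Gal_def field_automorphisms_over_def i r)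
  moreover have "inv_into UNIV \<tau> \<circ> \<tau> = id"
    using t(1) by (simp add: bij_is_inj)
  ultimately show "\<exists>\<rho>\<in>carrier (Gal K). \<rho> \<otimes>\<^bsub>Gal K\<^esub> \<tau> = \<one>\<^bsub>Gal K\<^esub>"
    by (auto simp: Gal_def)
qed (auto simp: Gal_def field_automorphisms_over_def bij_comp o_assoc)

definition generator_of :: "'a \<Rightarrow> ('a, 'b) monoid_scheme \<Rightarrow> bool" where
  "generator_of g G \<longleftrightarrow> g \<in> carrier G \<and> generate G {g} = carrier G"

text \<open>Following the exponential notation for the action of \<open>\<sigma>\<close>, the element
  \<open>x\<close> raised to \<open>\<sigma> ^ i\<close> is \<open>(\<sigma> ^^ i) x\<close>, and a sum of exponents becomes a product;
  for instance \<open>b\<close> raised to \<open>\<sigma> + 1\<close> is \<open>\<sigma> b * b\<close>.\<close>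

definition norm_map :: "('a::field \<Rightarrow> 'a) \<Rightarrow> nat \<Rightarrow> 'a \<Rightarrow> 'a" where
  "norm_map \<sigma> n x = (\<Prod>i<n. (\<sigma> ^^ i) x)"

definition w_param :: "('a::field \<Rightarrow> 'a) \<Rightarrow> 'a \<Rightarrow> 'a \<Rightarrow> 'a \<Rightarrow> 'a" where
  "w_param \<sigma> a b c = (\<sigma> a * c) / (\<sigma> b * b)"

definition z_param :: "('a::field \<Rightarrow> 'a) \<Rightarrow> 'a \<Rightarrow> 'a \<Rightarrow> 'a \<Rightarrow> 'a" where
  "z_param \<sigma> b c d = (\<sigma> b * d) / (\<sigma> c * c)"

fun H_seq :: "('a::field \<Rightarrow> 'a) \<Rightarrow> 'a \<Rightarrow> 'a \<Rightarrow> nat \<Rightarrow> 'a" where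
  "H_seq \<sigma> w z 0 = 1"
| "H_seq \<sigma> w z (Suc 0) = - 1"
| "H_seq \<sigma> w z (Suc (Suc 0)) = 1 - z"
| "H_seq \<sigma> w z (Suc (Suc (Suc k))) =
     - H_seq \<sigma> w z (Suc (Suc k))
     - (\<sigma> ^^ Suc k) z * H_seq \<sigma> w z (Suc k)
     - (\<sigma> ^^ Suc k) w * ((\<sigma> ^^ Suc k) z * (\<sigma> ^^ k) z) * H_seq \<sigma> w z k"

lemma H_seq_rec:
  assumes "k \<ge> 3"
  shows "H_seq \<sigma> w z k =
     - H_seq \<sigma> w z (k - 1)
     - (\<sigma> ^^ (k - 2)) z * H_seq \<sigma> w z (k - 2)
     - (\<sigma> ^^ (k - 2)) w * ((\<sigma> ^^ (k - 2)) z * (\<sigma> ^^ (k - 3)) z) * H_seq \<sigma> w z (k - 3)"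
proof -
  obtain j where "k = Suc (Suc (Suc j))"
    using assms by (metis Suc_le_D numeral_3_eq_3 Suc_le_mono)
  then show ?thesis by simp
qed

end

theory Submission
  imports Defs "HOL-Number_Theory.Residues" "HOL-Algebra.Algebraic_Closure_Type"
begin

(* Let t act on the field as \<sigma>; skew polynomials in t multiply by the rule t x = \<sigma>(x) t, and a
   nonzero one of degree m has at most q^m roots because q is the size of the fixed field.
   After division by d, the polynomial L has q^3 roots iff it divides t^n - 1 on the right: then
   t^n - 1 = Q L with Q of degree n - 3, so the image of L has at most q^(n-3) elements, and the
   converse holds because the remainder has degree at most 2. The t^2-coefficient of t^(k+2)
   modulo L satisfies a linear recurrence whose solution is H_k times the partial norm of c/d, and
   the vanishing of t^n - 1 modulo L can be read off the t^2-coefficients of t^n, t^(n+1), t^(n+2). *)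

section \<open>Root bounds for skew polynomials\<close>

text \<open>Every nonempty fibre of \<open>h\<close> is a translate of its kernel.\<close>

lemma card_additive_preimage_le:
  fixes h :: "'a::{ab_group_add,finite} \<Rightarrow> 'b::ab_group_add"
  assumes add: "\<And>x y. h (x + y) = h x + h y"
    and S: "finite S"
  shows "card {x. h x \<in> S} \<le> card S * card {x. h x = 0}"
proof -
  have diff: "h (x - y) = h x - h y" for x y
    using add[of "x - y" y] by (simp add: algebra_simps)
  have fibre: "card {x. h x = s} \<le> card {x. h x = 0}" for s
  proof (cases "\<exists>x0. h x0 = s")
    case True
    then obtain x0 where "h x0 = s" by blast
    then show ?thesis
      by (intro card_inj_on_le[where f = "\<lambda>x. x - x0"]) (auto simp: inj_on_def diff)
  qed simp
  have "{x. h x \<in> S} = (\<Union>s\<in>S. {x. h x = s})" by blast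
  then have "card {x. h x \<in> S} \<le> (\<Sum>s\<in>S. card {x. h x = s})"
    using card_UN_le[OF S] by simp
  also have "\<dots> \<le> of_nat (card S) * card {x. h x = 0}"
    by (rule sum_bounded_above) (rule fibre)
  finally show ?thesis by simp
qed

text \<open>Abel summation. When the \<open>c i\<close> sum to zero the boundary term drops out, and
  the skew polynomial with coefficients \<open>c\<close> factors through t - 1 on the right.\<close>

lemma sum_mult_by_parts:
  fixes c s :: "nat \<Rightarrow> 'a::comm_ring_1"
  shows "(\<Sum>i\<le>Suc m. c i * s i) =
    (\<Sum>i\<le>m. - (\<Sum>j\<le>i. c j) * (s (Suc i) - s i)) + (\<Sum>i\<le>Suc m. c i) * s (Suc m)"
  by (induction m) (simp_all add: algebra_simps)

locale field_automorphism =
  fixes \<sigma> :: "'a::{field,finite} \<Rightarrow> 'a"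
  assumes bij: "bij \<sigma>"
    and add: "\<sigma> (x + y) = \<sigma> x + \<sigma> y"
    and mult: "\<sigma> (x * y) = \<sigma> x * \<sigma> y"
begin

lemma zero [simp]: "\<sigma> 0 = 0"
  by (metis add add_0 add_cancel_left_right)

lemma eq_zero_iff [simp]: "\<sigma> x = 0 \<longleftrightarrow> x = 0"
  using bij by (metis bij_def inj_eq zero)

lemma one [simp]: "\<sigma> 1 = 1"
  using mult[of 1 1] eq_zero_iff[of 1] by simp

lemma minus: "\<sigma> (- x) = - \<sigma> x"
  using add[of x "- x"] by (simp add: eq_neg_iff_add_eq_0 add.commute)

lemma diff: "\<sigma> (x - y) = \<sigma> x - \<sigma> y"
  using add[of x "- y"] by (simp add: minus)

lemma inverse: "\<sigma> (inverse x) = inverse (\<sigma> x)"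
proof (cases "x = 0")
  case False
  then have "\<sigma> x * \<sigma> (inverse x) = 1" by (simp flip: mult)
  then show ?thesis by (metis inverse_unique)
qed simp

lemma divide: "\<sigma> (x / y) = \<sigma> x / \<sigma> y"
  by (simp add: divide_inverse mult inverse)

lemma power: "\<sigma> (x ^ k) = \<sigma> x ^ k"
  by (induction k) (simp_all add: mult)

lemma sum: "\<sigma> (\<Sum>i\<in>A. f i) = (\<Sum>i\<in>A. \<sigma> (f i))"
  by (induction A rule: infinite_finite_induct) (simp_all add: add)

lemma funpow: "field_automorphism (\<sigma> ^^ k)"
proof
  show "bij (\<sigma> ^^ k)" using bij by (rule bij_fn)
  show "(\<sigma> ^^ k) (x + y) = (\<sigma> ^^ k) x + (\<sigma> ^^ k) y" for x y
    by (induction k) (simp_all add: add)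
  show "(\<sigma> ^^ k) (x * y) = (\<sigma> ^^ k) x * (\<sigma> ^^ k) y" for x y
    by (induction k) (simp_all add: mult)
qed

text \<open>Induction on the degree: for a nonzero root \<open>u\<close>, substituting x = u y
  produces the root y = 1, hence a right factor t - 1. The kernel of this factor is the fixed field
  and contributes one factor of the bound; the induction hypothesis covers the quotient.\<close>

lemma card_skew_poly_roots_le:
  assumes "\<exists>i\<le>m. f i \<noteq> 0"
  shows "card {x. (\<Sum>i\<le>m. f i * (\<sigma> ^^ i) x) = 0} \<le> card {x. \<sigma> x = x} ^ m"
  using assms
proof (induction m arbitrary: f)
  case 0
  then have "{x. (\<Sum>i\<le>0. f i * (\<sigma> ^^ i) x) = 0} = {0}" by auto
  then show ?case by simp
next
  case (Suc m)
  interpret pw: field_automorphism "\<sigma> ^^ k" for k by (rule funpow)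
  let ?q = "card {x. \<sigma> x = x}"
  let ?R = "{x. (\<Sum>i\<le>Suc m. f i * (\<sigma> ^^ i) x) = 0}"
  have q: "?q \<ge> 1"
    using card_gt_0_iff[of "{x. \<sigma> x = x}"] zero by (fastforce simp: Suc_le_eq)
  show ?case
  proof (cases "\<exists>u\<in>?R. u \<noteq> 0")
    case False
    then have "?R \<subseteq> {0}" by blast
    then have "card ?R \<le> card {0::'a}" by (intro card_mono) simp_all
    also have "\<dots> \<le> ?q ^ Suc m" using one_le_power[OF q, of "Suc m"] by simp
    finally show ?thesis .
  next
    case True
    then obtain u where u: "u \<in> ?R" "u \<noteq> 0" by blast
    \<comment> \<open>The \<open>c i\<close> are the coefficients after substituting x = u y, and
      the \<open>e i\<close> those of the quotient by t - 1.\<close>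
    define c where "c i = f i * (\<sigma> ^^ i) u" for i
    define e where "e i = - (\<Sum>j\<le>i. c j)" for i
    have c0: "(\<Sum>i\<le>Suc m. c i) = 0" using u by (simp add: c_def)
    have e: "\<exists>i\<le>m. e i \<noteq> 0"
    proof (rule ccontr)
      assume "\<not> ?thesis"
      then have e0: "(\<Sum>j\<le>i. c j) = 0" if "i \<le> Suc m" for i
        using that c0 by (cases "i = Suc m") (auto simp: e_def)
      \<comment> \<open>Each \<open>c i\<close> is a partial sum or a difference of two consecutive
        ones.\<close>
      have "c i = 0" if "i \<le> Suc m" for i
        using e0[of i] e0[of "i - 1"] that by (cases i) auto
      then show False using Suc.prems u(2) by (auto simp: c_def)
    qed
    define g where "g = (\<lambda>x. \<Sum>i\<le>m. e i * (\<sigma> ^^ i) x)"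
    have "(\<Sum>i\<le>Suc m. f i * (\<sigma> ^^ i) (u * y)) = g (\<sigma> y - y)" for y
    proof -
      have "(\<Sum>i\<le>Suc m. f i * (\<sigma> ^^ i) (u * y)) = (\<Sum>i\<le>Suc m. c i * (\<sigma> ^^ i) y)"
        by (simp only: c_def pw.mult mult_ac)
      also have "\<dots> = g (\<sigma> y - y)"
        unfolding sum_mult_by_parts c0 g_def e_def
        by (simp add: pw.diff funpow_swap1)
      finally show ?thesis .
    qed
    then have "?R \<subseteq> (\<lambda>y. u * y) ` {y. \<sigma> y - y \<in> {x. g x = 0}}"
    proof (intro subsetI)
      fix x assume eq: "\<And>y. (\<Sum>i\<le>Suc m. f i * (\<sigma> ^^ i) (u * y)) = g (\<sigma> y - y)" and "x \<in> ?R"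
      then have "x = u * (x / u)" "g (\<sigma> (x / u) - x / u) = 0"
        using u(2) eq[of "x / u"] by simp_all
      then show "x \<in> (\<lambda>y. u * y) ` {y. \<sigma> y - y \<in> {x. g x = 0}}" by blast
    qed
    then have "card ?R \<le> card {y. \<sigma> y - y \<in> {x. g x = 0}}"
      by (meson card_image_le card_mono finite le_trans)
    also have "\<dots> \<le> card {x. g x = 0} * card {x. \<sigma> x - x = 0}"
      by (rule card_additive_preimage_le) (simp_all add: add)
    also have "\<dots> \<le> ?q ^ m * ?q"
      using Suc.IH[OF e] by (simp add: g_def)
    finally show ?thesis by (simp add: mult.commute)
  qed
qed

end

section \<open>Powers of \<open>\<sigma>\<close> modulo a cubic skew polynomial\<close>

(* The coefficients of 1, t, t^2 in the remainder of t^k modulo t^3 + r t^2 + s t + p. *)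
primrec skew_rem :: "('a::field \<Rightarrow> 'a) \<Rightarrow> 'a \<Rightarrow> 'a \<Rightarrow> 'a \<Rightarrow> nat \<Rightarrow> 'a \<times> 'a \<times> 'a" where
  "skew_rem \<sigma> p s r 0 = (1, 0, 0)"
| "skew_rem \<sigma> p s r (Suc k) = (case skew_rem \<sigma> p s r k of
     (\<alpha>, \<beta>, \<gamma>) \<Rightarrow> (- p * \<sigma> \<gamma>, \<sigma> \<alpha> - s * \<sigma> \<gamma>, \<sigma> \<beta> - r * \<sigma> \<gamma>))"

context field_automorphism
begin

context
  fixes p s r :: 'a
begin

abbreviation "rem0 k \<equiv> fst (skew_rem \<sigma> p s r k)"
abbreviation "rem1 k \<equiv> fst (snd (skew_rem \<sigma> p s r k))"
abbreviation "rem2 k \<equiv> snd (snd (skew_rem \<sigma> p s r k))"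

lemma rem_Suc:
  "rem0 (Suc k) = - p * \<sigma> (rem2 k)"
  "rem1 (Suc k) = \<sigma> (rem0 k) - s * \<sigma> (rem2 k)"
  "rem2 (Suc k) = \<sigma> (rem1 k) - r * \<sigma> (rem2 k)"
  by (simp_all split: prod.split)

declare skew_rem.simps(2) [simp del]

(* Multiplying t^3 + r t^2 + s t + p by t^k on the left gives a multiple of it. *)
lemma rem_recurrence:
  "rem0 (k + 3) = - (\<sigma> ^^ k) r * rem0 (k + 2) - (\<sigma> ^^ k) s * rem0 (k + 1) - (\<sigma> ^^ k) p * rem0 k"
  "rem1 (k + 3) = - (\<sigma> ^^ k) r * rem1 (k + 2) - (\<sigma> ^^ k) s * rem1 (k + 1) - (\<sigma> ^^ k) p * rem1 k"
  "rem2 (k + 3) = - (\<sigma> ^^ k) r * rem2 (k + 2) - (\<sigma> ^^ k) s * rem2 (k + 1) - (\<sigma> ^^ k) p * rem2 k"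
proof (induction k)
  case 0
  show "rem0 (0 + 3) = - (\<sigma> ^^ 0) r * rem0 (0 + 2) - (\<sigma> ^^ 0) s * rem0 (0 + 1) - (\<sigma> ^^ 0) p * rem0 0"
    "rem1 (0 + 3) = - (\<sigma> ^^ 0) r * rem1 (0 + 2) - (\<sigma> ^^ 0) s * rem1 (0 + 1) - (\<sigma> ^^ 0) p * rem1 0"
    "rem2 (0 + 3) = - (\<sigma> ^^ 0) r * rem2 (0 + 2) - (\<sigma> ^^ 0) s * rem2 (0 + 1) - (\<sigma> ^^ 0) p * rem2 0"
    by (simp_all add: numeral_3_eq_3 numeral_2_eq_2 rem_Suc)
next
  case (Suc k)
  have shift: "Suc k + i = Suc (k + i)" for i by simp
  show "rem0 (Suc k + 3) = - (\<sigma> ^^ Suc k) r * rem0 (Suc k + 2) - (\<sigma> ^^ Suc k) s * rem0 (Suc k + 1) - (\<sigma> ^^ Suc k) p * rem0 (Suc k)"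
    "rem1 (Suc k + 3) = - (\<sigma> ^^ Suc k) r * rem1 (Suc k + 2) - (\<sigma> ^^ Suc k) s * rem1 (Suc k + 1) - (\<sigma> ^^ Suc k) p * rem1 (Suc k)"
    "rem2 (Suc k + 3) = - (\<sigma> ^^ Suc k) r * rem2 (Suc k + 2) - (\<sigma> ^^ Suc k) s * rem2 (Suc k + 1) - (\<sigma> ^^ Suc k) p * rem2 (Suc k)"
    \<comment> \<open>The passage from \<open>k\<close> to \<open>Suc k\<close> in
      \<open>rem_Suc\<close> is \<sigma>-semilinear in the triple, so it carries the three
      recurrences along together.\<close>
    unfolding shift rem_Suc Suc by (simp_all add: add diff mult minus algebra_simps)
qed

text \<open>Dividing the recurrence for \<open>rem2\<close> by the partial norm of \<open>r\<close>
  turns its leading coefficient into -1; the other two become the products of conjugates of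
  \<open>w\<close> and \<open>z\<close> in \<open>H_seq\<close>. The shift by 2 skips the initial
  values 0, 0 of \<open>rem2\<close>.\<close>

lemma rem2_eq_H_seq:
  assumes "s \<noteq> 0" "r \<noteq> 0"
    and w: "w = (\<sigma> p * r) / (\<sigma> s * s)"
    and z: "z = \<sigma> s / (\<sigma> r * r)"
  shows "rem2 (k + 2) = H_seq \<sigma> w z k * (\<Prod>i<k. (\<sigma> ^^ i) r)"
proof -
  interpret pw: field_automorphism "\<sigma> ^^ k" for k by (rule funpow)
  have rem2: "rem2 (Suc (Suc 0)) = 1" "rem2 (Suc 0) = 0"
    by (simp_all add: rem_Suc)
  have shift: "rem2 (Suc (Suc (Suc k))) =
      - (\<sigma> ^^ k) r * rem2 (Suc (Suc k)) - (\<sigma> ^^ k) s * rem2 (Suc k) - (\<sigma> ^^ k) p * rem2 k" for k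
    using rem_recurrence(3)[of k] by (simp add: numeral_3_eq_3 numeral_2_eq_2)
  show ?thesis
  proof (rule H_seq.induct[of "\<lambda>_ _ _ k. rem2 (k + 2) = H_seq \<sigma> w z k * (\<Prod>i<k. (\<sigma> ^^ i) r)" \<sigma> w z], goal_cases)
    case (4 _ _ _ k)
    have zk: "(\<sigma> ^^ j) z = (\<sigma> ^^ Suc j) s / ((\<sigma> ^^ Suc j) r * (\<sigma> ^^ j) r)" for j
      unfolding z by (simp add: pw.divide pw.mult funpow_swap1)
    have wk: "(\<sigma> ^^ j) w = (\<sigma> ^^ Suc j) p * (\<sigma> ^^ j) r / ((\<sigma> ^^ Suc j) s * (\<sigma> ^^ j) s)" for j
      unfolding w by (simp add: pw.divide pw.mult funpow_swap1)
    have nz: "(\<sigma> ^^ j) r \<noteq> 0" "(\<sigma> ^^ j) s \<noteq> 0" for j using assms by simp_all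
    define P where "P = (\<Prod>i<k. (\<sigma> ^^ i) r)"
    have IH: "rem2 (Suc (Suc k)) = H_seq \<sigma> w z k * P"
      "rem2 (Suc (Suc (Suc k))) = H_seq \<sigma> w z (Suc k) * (P * (\<sigma> ^^ k) r)"
      "rem2 (Suc (Suc (Suc (Suc k)))) = H_seq \<sigma> w z (Suc (Suc k)) * (P * (\<sigma> ^^ k) r * (\<sigma> ^^ Suc k) r)"
      using 4 by (simp_all add: P_def)
    have "rem2 (Suc (Suc (Suc k)) + 2) = H_seq \<sigma> w z (Suc (Suc (Suc k))) *
        (P * (\<sigma> ^^ k) r * (\<sigma> ^^ Suc k) r * (\<sigma> ^^ Suc (Suc k)) r)"
      unfolding add_2_eq_Suc' shift[of "Suc (Suc k)"] IH H_seq.simps zk wk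
      using nz[of k] nz[of "Suc k"] nz[of "Suc (Suc k)"]
      \<comment> \<open>The deleted rules would rewrite the iterates and reduce the facts
        \<open>nz\<close> to statements about \<open>r\<close> and \<open>s\<close>, which no longer
        match the denominators.\<close>
      by (simp add: field_simps del: funpow.simps eq_zero_iff pw.eq_zero_iff)
    then show ?case by (simp add: P_def)
  qed (use assms in \<open>simp_all add: rem2 shift field_simps\<close>)
qed

text \<open>Each multiplication by t moves the coefficients up one place: if \<open>rem2 n\<close>
  vanishes, the next \<open>rem2\<close> is \<sigma> of \<open>rem1 n\<close>, and if that vanishes
  too, the one after is \<sigma>^2 of \<open>rem0 n\<close>. Injectivity of \<sigma> does the
  rest.\<close>

lemma skew_rem_eq_one_iff:
  "skew_rem \<sigma> p s r n = (1, 0, 0) \<longleftrightarrow> rem2 n = 0 \<and> rem2 (n + 1) = 0 \<and> rem2 (n + 2) = 1"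
proof -
  have "rem2 n = 0 \<and> rem2 (n + 1) = 0 \<longleftrightarrow> rem2 n = 0 \<and> rem1 n = 0"
    by (auto simp: rem_Suc)
  moreover have "rem2 (n + 2) = 1 \<longleftrightarrow> rem0 n = 1" if "rem2 n = 0" "rem1 n = 0"
  proof -
    have "rem2 (n + 2) = \<sigma> (\<sigma> (rem0 n))" using that by (simp add: rem_Suc)
    then show ?thesis using bij by (metis bij_def inj_eq one)
  qed
  ultimately show ?thesis
    unfolding prod_eq_iff fst_conv snd_conv by blast
qed

abbreviation (input) "cubic x \<equiv> (\<sigma> ^^ 3) x + r * (\<sigma> ^^ 2) x + s * \<sigma> x + p * x"

text \<open>Right division of t^(j+3) by the cubic. The condition \<open>e j = 1\<close> records
  that the quotient is monic of degree \<open>j\<close>, so that the root bound applies to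
  it.\<close>

lemma funpow_eq_quotient_rem:
  "\<exists>e. e j = 1 \<and> (\<forall>x. (\<sigma> ^^ (j + 3)) x = (\<Sum>i\<le>j. e i * (\<sigma> ^^ i) (cubic x)) +
     rem0 (j + 3) * x + rem1 (j + 3) * \<sigma> x + rem2 (j + 3) * (\<sigma> ^^ 2) x)"
proof (induction j)
  case 0
  show ?case
    by (intro exI[of _ "\<lambda>_. 1"]) (simp add: numeral_3_eq_3 numeral_2_eq_2 rem_Suc)
next
  case (Suc j)
  then obtain e where e: "e j = 1" and *: "\<And>x. (\<sigma> ^^ (j + 3)) x = (\<Sum>i\<le>j. e i * (\<sigma> ^^ i) (cubic x)) +
     rem0 (j + 3) * x + rem1 (j + 3) * \<sigma> x + rem2 (j + 3) * (\<sigma> ^^ 2) x"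
    by blast
  \<comment> \<open>Multiplying by t on the left shifts the quotient up; the new constant term pays
    for reducing the t^3 that arises from the remainder.\<close>
  define e' where "e' i = (case i of 0 \<Rightarrow> \<sigma> (rem2 (j + 3)) | Suc i \<Rightarrow> \<sigma> (e i))" for i
  have "(\<sigma> ^^ (Suc j + 3)) x = (\<Sum>i\<le>Suc j. e' i * (\<sigma> ^^ i) (cubic x)) +
     rem0 (Suc j + 3) * x + rem1 (Suc j + 3) * \<sigma> x + rem2 (Suc j + 3) * (\<sigma> ^^ 2) x" for x
  proof -
    have "(\<sigma> ^^ (Suc j + 3)) x = \<sigma> ((\<sigma> ^^ (j + 3)) x)" by (simp only: add_Suc funpow.simps o_apply)
    also have "\<dots> = (\<Sum>i\<le>j. \<sigma> (e i) * (\<sigma> ^^ Suc i) (cubic x)) +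
      \<sigma> (rem0 (j + 3)) * \<sigma> x + \<sigma> (rem1 (j + 3)) * (\<sigma> ^^ 2) x + \<sigma> (rem2 (j + 3)) * (\<sigma> ^^ 3) x"
      unfolding * by (simp add: add mult sum numeral_3_eq_3 numeral_2_eq_2)
    also have "(\<Sum>i\<le>j. \<sigma> (e i) * (\<sigma> ^^ Suc i) (cubic x)) =
        (\<Sum>i\<le>Suc j. e' i * (\<sigma> ^^ i) (cubic x)) - \<sigma> (rem2 (j + 3)) * cubic x"
      unfolding sum.atMost_Suc_shift e'_def by simp
    finally show ?thesis
      unfolding add_Suc rem_Suc by (simp add: algebra_simps)
  qed
  moreover have "e' (Suc j) = 1" by (simp add: e'_def e)
  ultimately show ?case by blast
qed

text \<open>On roots of the cubic the quotient contributes nothing, so t^3 is replaced directly at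
  each step, for every \<open>k\<close>.\<close>

lemma funpow_eq_rem_on_roots:
  assumes "cubic x = 0"
  shows "(\<sigma> ^^ k) x = rem0 k * x + rem1 k * \<sigma> x + rem2 k * (\<sigma> ^^ 2) x"
proof (induction k)
  case (Suc k)
  have x3: "(\<sigma> ^^ 3) x = - r * (\<sigma> ^^ 2) x - s * \<sigma> x - p * x"
    using assms by (simp add: algebra_simps eq_neg_iff_add_eq_0)
  have "(\<sigma> ^^ Suc k) x = \<sigma> ((\<sigma> ^^ k) x)" by simp
  also have "\<dots> = \<sigma> (rem0 k) * \<sigma> x + \<sigma> (rem1 k) * (\<sigma> ^^ 2) x + \<sigma> (rem2 k) * (\<sigma> ^^ 3) x"
    unfolding Suc by (simp add: add mult numeral_3_eq_3 numeral_2_eq_2)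
  finally show ?case unfolding x3 by (simp add: rem_Suc algebra_simps)
qed simp

lemma card_cubic_roots_iff:
  assumes q: "card {x. \<sigma> x = x} = q" "q > 1"
    and card: "card (UNIV :: 'a set) = q ^ n"
    and n: "n \<ge> 3"
    and order: "\<sigma> ^^ n = id"
  shows "card {x. cubic x = 0} = q ^ 3 \<longleftrightarrow> skew_rem \<sigma> p s r n = (1, 0, 0)"
proof
  assume *: "card {x. cubic x = 0} = q ^ 3"
  \<comment> \<open>The remainder of t^n - 1. It vanishes on all q^3 roots, more than a nonzero skew
    polynomial of degree at most 2 can have.\<close>
  define f where "f i = (case i of 0 \<Rightarrow> rem0 n - 1 | Suc 0 \<Rightarrow> rem1 n | _ \<Rightarrow> rem2 n)" for i :: nat
  have "(\<Sum>i\<le>2. f i * (\<sigma> ^^ i) x) = 0" if "cubic x = 0" for x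
    using funpow_eq_rem_on_roots[OF that, of n]
    by (simp add: order f_def numeral_2_eq_2 algebra_simps)
  then have "card {x. cubic x = 0} \<le> card {x. (\<Sum>i\<le>2. f i * (\<sigma> ^^ i) x) = 0}"
    by (intro card_mono) auto
  moreover have "q ^ 2 < q ^ 3"
    using q by (intro power_strict_increasing) simp_all
  ultimately have "\<not> card {x. (\<Sum>i\<le>2. f i * (\<sigma> ^^ i) x) = 0} \<le> card {x. \<sigma> x = x} ^ 2"
    unfolding * q(1) by linarith
  then have "\<not> (\<exists>i\<le>2. f i \<noteq> 0)"
    using card_skew_poly_roots_le[of 2 f] by blast
  then have "f 0 = 0" "f 1 = 0" "f 2 = 0" by auto
  then show "skew_rem \<sigma> p s r n = (1, 0, 0)"
    by (cases "skew_rem \<sigma> p s r n") (simp add: f_def numeral_2_eq_2)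
next
  interpret pw: field_automorphism "\<sigma> ^^ k" for k by (rule funpow)
  assume *: "skew_rem \<sigma> p s r n = (1, 0, 0)"
  obtain e where e: "e (n - 3) = 1" and
    quot: "\<And>x. (\<sigma> ^^ (n - 3 + 3)) x = (\<Sum>i\<le>n - 3. e i * (\<sigma> ^^ i) (cubic x)) +
     rem0 (n - 3 + 3) * x + rem1 (n - 3 + 3) * \<sigma> x + rem2 (n - 3 + 3) * (\<sigma> ^^ 2) x"
    using funpow_eq_quotient_rem[of "n - 3"] by blast
  define Q where "Q = {y. (\<Sum>i\<le>n - 3. e i * (\<sigma> ^^ i) y) = 0}"
  \<comment> \<open>Here the division reads x = Q(cubic x) + x, because \<sigma>^n is the identity
    and the remainder is 1.\<close>
  have "cubic x \<in> Q" for x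
    using quot[of x] n * by (simp add: Q_def order)
  \<comment> \<open>The whole field maps into the kernel \<open>Q\<close> of the quotient, so the
    kernel of the cubic must be large.\<close>
  then have "q ^ n = card {x. cubic x \<in> Q}" using card by simp
  also have "\<dots> \<le> card Q * card {x. cubic x = 0}"
    by (rule card_additive_preimage_le) (simp_all add: pw.add add distrib_left)
  also have "\<dots> \<le> q ^ (n - 3) * card {x. cubic x = 0}"
  proof (rule mult_right_mono)
    have "\<exists>i\<le>n - 3. e i \<noteq> 0" using e by (intro exI[of _ "n - 3"]) simp
    from card_skew_poly_roots_le[OF this] show "card Q \<le> q ^ (n - 3)"
      unfolding Q_def q(1) .
  qed simp
  finally have "q ^ (n - 3) * q ^ 3 \<le> q ^ (n - 3) * card {x. cubic x = 0}"
    using n by (simp flip: power_add)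
  then have "q ^ 3 \<le> card {x. cubic x = 0}" using q by simp
  moreover have "card {x. cubic x = 0} \<le> q ^ 3"
  proof -
    define f where "f i = (if i = 0 then p else if i = 1 then s else if i = 2 then r else 1)" for i :: nat
    have "(\<Sum>i\<le>3. f i * (\<sigma> ^^ i) x) = cubic x" for x
      by (simp add: f_def numeral_3_eq_3 numeral_2_eq_2 algebra_simps)
    moreover have "\<exists>i\<le>3. f i \<noteq> 0" by (intro exI[of _ 3]) (simp add: f_def)
    ultimately show ?thesis
      using card_skew_poly_roots_le[of 3 f] q by simp
  qed
  ultimately show "card {x. cubic x = 0} = q ^ 3" by simp
qed

end

end

section \<open>The order and the fixed field of \<open>\<sigma>\<close>\<close>

text \<open>Cyclicity of the multiplicative group, carried over from the carrier-based field
  \<open>ring_of_type_algebra\<close> to the type class.\<close>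

lemma finite_field_generator:
  "\<exists>g :: 'a::{field,finite}. \<forall>x. x \<noteq> 0 \<longrightarrow> (\<exists>i. x = g ^ i)"
proof -
  let ?R = "ring_of_type_algebra :: 'a ring"
  have pow: "x [^]\<^bsub>?R\<^esub> i = x ^ i" for x :: 'a and i :: nat
    by (induction i) (simp_all add: ring_of_type_algebra_def nat_pow_def mult.commute)
  interpret field ?R by (rule field_from_type_algebra)
  have R: "carrier (mult_of ?R) = - {0}"
    by (auto simp: ring_of_type_algebra_def)
  obtain g where "carrier (mult_of ?R) = {g [^]\<^bsub>?R\<^esub> i | i::nat. i \<in> UNIV}"
    using finite_field_mult_group_has_gen by auto
  then have "\<forall>x. x \<noteq> 0 \<longrightarrow> (\<exists>i. x = g ^ i)"
    unfolding R pow by blast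
  then show ?thesis by blast
qed

context field_automorphism
begin

(* The orbit of a generator g of the multiplicative group consists of roots of a polynomial of
   degree n over the fixed field, which exists by counting; so some 0 < m <= n has \<sigma>^m = id, and
   the root bound for t^m - 1 gives m = n. *)
lemma funpow_eq_id:
  assumes q: "card {x. \<sigma> x = x} = q" "q > 1"
    and card: "card (UNIV :: 'a set) = q ^ n"
  shows "\<sigma> ^^ n = id"
proof -
  interpret pw: field_automorphism "\<sigma> ^^ k" for k by (rule funpow)
  let ?F = "{x. \<sigma> x = x}"
  obtain g :: 'a where g: "\<And>x. x \<noteq> 0 \<Longrightarrow> \<exists>i. x = g ^ i"
    using finite_field_generator by blast
  let ?ev = "\<lambda>f. \<Sum>i\<le>n. f i * g ^ i"
  \<comment> \<open>Pigeonhole: there are q^(n+1) coefficient tuples over the fixed field but only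
    q^n possible values at \<open>g\<close>.\<close>
  have "card ({..n} \<rightarrow>\<^sub>E ?F) = q ^ Suc n"
    by (simp add: card_PiE q(1))
  then have "\<not> inj_on ?ev ({..n} \<rightarrow>\<^sub>E ?F)"
    using card_inj_on_le[of ?ev "{..n} \<rightarrow>\<^sub>E ?F" UNIV] card q(2) by auto
  then obtain f1 f2 where f: "f1 \<in> {..n} \<rightarrow>\<^sub>E ?F" "f2 \<in> {..n} \<rightarrow>\<^sub>E ?F" "f1 \<noteq> f2" "?ev f1 = ?ev f2"
    unfolding inj_on_def by blast
  define h where "h i = f1 i - f2 i" for i
  have h_fixed: "\<sigma> (h i) = h i" if "i \<le> n" for i
    using f that by (auto simp: h_def diff PiE_iff)
  obtain i0 where i0: "i0 \<le> n" "h i0 \<noteq> 0"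
    using PiE_ext[OF f(1,2)] f(3) by (auto simp: h_def)
  define p where "p = (\<Sum>i\<le>n. Polynomial.monom (h i) i)"
  have poly_p: "poly p x = (\<Sum>i\<le>n. h i * x ^ i)" for x
    by (simp add: p_def poly_sum poly_monom)
  have "Polynomial.coeff p i0 = h i0"
    using i0 by (simp add: p_def Polynomial.coeff_sum)
  then have "p \<noteq> 0" using i0 by auto
  moreover have "Polynomial.degree p \<le> n"
    unfolding p_def by (intro degree_sum_le) (auto intro: degree_monom_le le_trans)
  ultimately have roots: "card {x. poly p x = 0} \<le> n"
    using card_poly_roots_bound[of p] by linarith
  have "poly p g = 0"
    using f(4) by (simp add: poly_p h_def left_diff_distrib sum_subtractf)
  \<comment> \<open>The coefficients of \<open>p\<close> are fixed by \<sigma>, so \<sigma> permutes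
    the roots of \<open>p\<close>.\<close>
  moreover have "\<sigma> (poly p x) = poly p (\<sigma> x)" for x
    by (simp add: poly_p sum mult power h_fixed)
  ultimately have orbit: "poly p ((\<sigma> ^^ k) g) = 0" for k
    by (induction k) (simp_all, metis zero)
  have "\<not> inj_on (\<lambda>k. (\<sigma> ^^ k) g) {..n}"
  proof
    assume "inj_on (\<lambda>k. (\<sigma> ^^ k) g) {..n}"
    then have "card {..n} \<le> card {x. poly p x = 0}"
      by (rule card_inj_on_le) (auto simp: orbit)
    then show False using roots by simp
  qed
  then obtain i j where ij: "i < j" "j \<le> n" "(\<sigma> ^^ i) g = (\<sigma> ^^ j) g"
    unfolding inj_on_def by (metis atMost_iff linorder_neqE_nat)
  define m where "m = j - i"
  have m: "m > 0" "m \<le> n" using ij by (auto simp: m_def)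
  have "(\<sigma> ^^ i) ((\<sigma> ^^ m) g) = (\<sigma> ^^ i) g"
    using ij by (simp add: m_def flip: funpow_add comp_apply[of "\<sigma> ^^ i" "\<sigma> ^^ (j - i)"])
  then have "(\<sigma> ^^ m) g = g"
    using pw.bij[of i] by (simp add: bij_def inj_eq)
  then have id: "(\<sigma> ^^ m) x = x" for x
    using g[of x] by (cases "x = 0") (auto simp: pw.power)
  \<comment> \<open>The skew polynomial t^m - 1, which vanishes on the whole field.\<close>
  define e where "e i = (if i = m then 1 else if i = 0 then - 1 else 0 :: 'a)" for i
  have "(\<Sum>i\<le>m. e i * (\<sigma> ^^ i) x) = (\<Sum>i\<in>{0, m}. e i * (\<sigma> ^^ i) x)" for x
    by (rule sum.mono_neutral_right) (auto simp: e_def)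
  then have "(\<Sum>i\<le>m. e i * (\<sigma> ^^ i) x) = 0" for x
    using m by (simp add: e_def id)
  moreover have "\<exists>i\<le>m. e i \<noteq> 0" by (intro exI[of _ m]) (simp add: e_def)
  ultimately have "q ^ n \<le> q ^ m"
    using card_skew_poly_roots_le[of m e] card q(1) by simp
  then have "n \<le> m" using q(2) by simp
  then show ?thesis using id m by auto
qed

end

section \<open>The Frobenius map and the fixed field of a generator of the Galois group\<close>

lemma field_automorphism_Gal:
  "\<tau> \<in> carrier (Gal K) \<Longrightarrow> field_automorphism (\<tau> :: 'a::{field,finite} \<Rightarrow> 'a)"
  by (simp add: Gal_def field_automorphisms_over_def field_automorphism_def)

text \<open>Allows passing from \<sigma> to the Frobenius map without writing the latter as a power
  of \<sigma>.\<close>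

lemma generate_Gal_fixes:
  assumes "\<tau> \<in> generate (Gal K) {\<sigma>}" and \<sigma>: "\<sigma> \<in> carrier (Gal K)" and fixed: "\<sigma> x = x"
  shows "\<tau> x = x"
  using assms(1)
proof (induction rule: generate.induct)
  case (inv h)
  have "inv\<^bsub>Gal K\<^esub> \<sigma> \<otimes>\<^bsub>Gal K\<^esub> \<sigma> = \<one>\<^bsub>Gal K\<^esub>"
    using \<sigma> by (rule group.l_inv[OF group_Gal])
  then have "(inv\<^bsub>Gal K\<^esub> \<sigma>) (\<sigma> x) = x"
    by (simp add: Gal_def fun_eq_iff)
  then show ?case using inv fixed by simp
qed (auto simp: Gal_def fixed)

text \<open>Fermat's argument: multiplication by a nonzero \<open>x\<close> permutes the nonzero
  elements of \<open>K\<close>, so it preserves their product.\<close>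

lemma power_card_subfield:
  fixes K :: "'a::{field,finite} set"
  assumes K: "is_subfield K" and x: "x \<in> K"
  shows "x ^ card K = x"
proof (cases "x = 0")
  case True
  then show ?thesis using x by (auto simp: card_gt_0_iff)
next
  case False
  have "(*) x ` (K - {0}) = K - {0}"
  proof (rule card_seteq)
    show "(*) x ` (K - {0}) \<subseteq> K - {0}"
      using K x False by (auto simp: is_subfield_def)
    show "card (K - {0}) \<le> card ((*) x ` (K - {0}))"
      using False by (simp add: card_image inj_on_def)
  qed simp
  then have "\<Prod>(K - {0}) = \<Prod>((*) x ` (K - {0}))" by simp
  also have "\<dots> = (\<Prod>y\<in>K - {0}. x * y)"
    using False by (subst prod.reindex) (auto simp: inj_on_def)
  also have "\<dots> = x ^ card (K - {0}) * \<Prod>(K - {0})"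
    by (simp add: prod.distrib)
  finally have "x ^ card (K - {0}) = 1" by simp
  moreover have "card K = Suc (card (K - {0}))"
    using K card_Suc_Diff1[of K 0] by (simp add: is_subfield_def)
  ultimately show ?thesis by simp
qed

text \<open>Additivity holds because \<open>q\<close> is a power of the characteristic; injectivity
  then follows from the trivial kernel, and bijectivity from finiteness.\<close>

lemma frobenius_in_Gal:
  fixes K :: "'a::{field,finite} set"
  assumes "primepow q" "card (UNIV :: 'a set) = q ^ n" "is_subfield K" "card K = q"
  shows "(\<lambda>x. x ^ q) \<in> carrier (Gal K)"
proof -
  obtain p k where p: "Factorial_Ring.prime p" "k > 0" "q = p ^ k"
    using assms(1) by (auto simp: primepow_def)
  have char: "Factorial_Ring.prime CHAR('a)"
    by (intro prime_CHAR_semidom finite_imp_CHAR_pos) simp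
  have "CHAR('a) dvd (p ^ k) ^ n"
    using CHAR_dvd_CARD[where 'a = 'a] assms(2) p(3) by simp
  then have "CHAR('a) = p"
    using char p(1) by (metis prime_dvd_power primes_dvd_imp_eq)
  then have add: "(x + y) ^ q = x ^ q + y ^ q" for x y :: 'a
    using freshmans_dream'[OF char] p(3) by simp
  have "inj (\<lambda>x :: 'a. x ^ q)"
  proof (rule injI)
    fix x y :: 'a assume "x ^ q = y ^ q"
    then have "(x - y) ^ q = 0" using add[of "x - y" y] by simp
    then show "x = y" by simp
  qed
  then have "bij (\<lambda>x :: 'a. x ^ q)"
    by (simp add: bij_def finite_UNIV_inj_surj)
  then show ?thesis
    using assms add power_card_subfield
    by (auto simp: Gal_def field_automorphisms_over_def power_mult_distrib)
qed

text \<open>An element fixed by \<sigma> is fixed by the Frobenius map, hence is a root of X^q - X.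
  The q elements of \<open>K\<close> already exhaust these roots.\<close>

lemma fixed_field_generator_Gal:
  fixes K :: "'a::{field,finite} set"
  assumes "primepow q" "card (UNIV :: 'a set) = q ^ n" "is_subfield K" "card K = q"
    and gen: "generator_of \<sigma> (Gal K)"
  shows "{x. \<sigma> x = x} = K"
proof
  show "K \<subseteq> {x. \<sigma> x = x}"
    using gen by (auto simp: generator_of_def Gal_def field_automorphisms_over_def)
  have "q > 1" using primepow_gt_Suc_0[OF assms(1)] by simp
  let ?p = "Polynomial.monom 1 q - Polynomial.monom 1 1 :: 'a poly"
  have "Polynomial.coeff ?p q = 1" using \<open>q > 1\<close> by simp
  then have "?p \<noteq> 0" by (metis Polynomial.coeff_0 zero_neq_one)
  then have "card {x. poly ?p x = 0} \<le> Polynomial.degree ?p"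
    by (rule card_poly_roots_bound)
  also have "\<dots> \<le> q"
    using \<open>q > 1\<close> by (intro degree_diff_le) (simp_all add: degree_monom_eq)
  finally have "card {x :: 'a. x ^ q = x} \<le> card K"
    using assms(4) by (simp add: poly_monom)
  moreover have "K \<subseteq> {x. x ^ q = x}"
    using power_card_subfield[OF assms(3)] assms(4) by auto
  ultimately have "K = {x. x ^ q = x}"
    by (intro card_seteq) simp_all
  moreover have "x ^ q = x" if "\<sigma> x = x" for x
    using generate_Gal_fixes[of "\<lambda>x. x ^ q" K \<sigma> x] frobenius_in_Gal[OF assms(1-4)] gen that
    by (simp add: generator_of_def)
  ultimately show "{x. \<sigma> x = x} \<subseteq> K" by blast
qed

theorem theorem14:
  fixes K :: "'a::{field,finite} set"
    and q n :: nat
    and \<sigma> :: "'a \<Rightarrow> 'a"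
    and a b c d w z :: 'a
  assumes "primepow q"
    and "n \<ge> 3"
    and "card (UNIV :: 'a set) = q ^ n"
    and "is_subfield K"
    and "card K = q"
    and "generator_of \<sigma> (Gal K)"
    and "a * b * c * d \<noteq> 0"
    and "w = w_param \<sigma> a b c"
    and "z = z_param \<sigma> b c d"
  shows "card {x. a * x + b * \<sigma> x + c * (\<sigma> ^^ 2) x + d * (\<sigma> ^^ 3) x = 0} = q ^ 3 \<longleftrightarrow>
    H_seq \<sigma> w z (n - 1) = 0 \<and> H_seq \<sigma> w z (n - 2) = 0 \<and>
    H_seq \<sigma> w z n * norm_map \<sigma> n (c / d) = 1"
proof -
  have \<sigma>: "\<sigma> \<in> carrier (Gal K)" using assms(6) by (simp add: generator_of_def)
  interpret field_automorphism \<sigma> using \<sigma> by (rule field_automorphism_Gal)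
  interpret pw: field_automorphism "\<sigma> ^^ k" for k by (rule funpow)
  have q: "card {x. \<sigma> x = x} = q"
    using fixed_field_generator_Gal[OF assms(1,3,4,5,6)] assms(5) by simp
  have q1: "q > 1" using primepow_gt_Suc_0[OF assms(1)] by simp
  have nz: "a \<noteq> 0" "b \<noteq> 0" "c \<noteq> 0" "d \<noteq> 0" using assms(7) by auto
  \<comment> \<open>Division by \<open>d\<close> makes the cubic monic without changing its
    roots.\<close>
  define p s r where "p = a / d" and "s = b / d" and "r = c / d"
  have "a * x + b * \<sigma> x + c * (\<sigma> ^^ 2) x + d * (\<sigma> ^^ 3) x =
      d * ((\<sigma> ^^ 3) x + r * (\<sigma> ^^ 2) x + s * \<sigma> x + p * x)" for x
    using nz by (simp add: p_def s_def r_def field_simps)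
  then have "card {x. a * x + b * \<sigma> x + c * (\<sigma> ^^ 2) x + d * (\<sigma> ^^ 3) x = 0} = q ^ 3 \<longleftrightarrow>
      card {x. (\<sigma> ^^ 3) x + r * (\<sigma> ^^ 2) x + s * \<sigma> x + p * x = 0} = q ^ 3"
    using nz by simp
  also have "\<dots> \<longleftrightarrow> skew_rem \<sigma> p s r n = (1, 0, 0)"
    using card_cubic_roots_iff[OF q q1 assms(3,2) funpow_eq_id[OF q q1 assms(3)]] .
  also have "\<dots> \<longleftrightarrow> rem2 p s r (n - 2 + 2) = 0 \<and> rem2 p s r (n - 1 + 2) = 0 \<and> rem2 p s r (n + 2) = 1"
  proof -
    \<comment> \<open>The indices are written as \<open>k + 2\<close> so that
      \<open>rem2_eq_H_seq\<close> applies with \<open>k\<close> equal to n - 2, n - 1 and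
      n.\<close>
    have "n - 2 + 2 = n" "n - 1 + 2 = n + 1" using assms(2) by simp_all
    then show ?thesis by (simp only: skew_rem_eq_one_iff)
  qed
  also have "\<dots> \<longleftrightarrow> H_seq \<sigma> w z (n - 2) = 0 \<and> H_seq \<sigma> w z (n - 1) = 0 \<and>
      H_seq \<sigma> w z n * norm_map \<sigma> n (c / d) = 1"
  proof -
    have "s \<noteq> 0" "r \<noteq> 0" using nz by (simp_all add: s_def r_def)
    moreover have "w = (\<sigma> p * r) / (\<sigma> s * s)"
      using nz by (simp add: assms(8) w_param_def p_def s_def r_def divide field_simps)
    moreover have "z = \<sigma> s / (\<sigma> r * r)"
      using nz by (simp add: assms(9) z_param_def s_def r_def divide field_simps)
    ultimately have "rem2 p s r (k + 2) = H_seq \<sigma> w z k * (\<Prod>i<k. (\<sigma> ^^ i) r)" for k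
      by (rule rem2_eq_H_seq)
    \<comment> \<open>Nonzero partial norms do not affect the two vanishing conditions; for
      \<open>k = n\<close> the product is the full norm of \<open>c / d\<close>.\<close>
    moreover have "(\<Prod>i<k. (\<sigma> ^^ i) r) \<noteq> 0" for k using \<open>r \<noteq> 0\<close> by simp
    ultimately show ?thesis by (simp add: norm_map_def r_def nz)
  qed
  finally show ?thesis by blast
qed

end
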